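(* Let $\gamma$ be a Keplerian ellipse, i.e. a solution of $\mu\ddot\gamma(t)=-\dfrac{m}{|\gamma(t)|^3}\gamma(t)$ in $\mathbb{R}^2\setminus\{0\}$ which is periodic with prime (minimal) period $T>0$. Then $\gamma$ is elliptic, meaning that all the eigenvalues of its monodromy matrix belong to the unit circle $\mathbb{U}\subset\mathbb{C}$. Moreover, $\gamma$ is spectrally stable and not linearly stable.
   Context: Here $\mu>0$ and $m>0$ are constants. The Kepler equation is equivalent to the Hamiltonian system $\dot z=J\nabla H(z)$ for $z=(p,q)\in\mathbb{R}^2\times(\mathbb{R}^2\setminus\{0\})$, where $H(p,q)=\frac{|p|^2}{2\mu}-\frac{m}{|q|}$ and $J=\begin{bmatrix}0&-I\\ I&0\end{bmatrix}$ is the $4\times4$ matrix with $2\times 2$ blocks. Put $z_\gamma(t)=(\mu\dot\gamma(t),\gamma(t))$. The fundamental solution is the matrix path $\phi$ with $\dot\phi(t)=J\,D^2H(z_\gamma(t))\,\phi(t)$, $\phi(0)=I$; the monodromy matrix of $\gamma$ is $M=\phi(T)$. The periodic orbit $\gamma$ is spectrally stable if all eigenvalues of $M$ lie on $\mathbb{U}$, and linearly stable if it is spectrally stable and moreover $M$ is diagonalizable (over $\mathbb{C}$). *)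

theory Defs
  imports "HOL-Analysis.Analysis"
begin

section \<open>Complex eigenvalues and diagonalizability\<close>

definition eigenvalue :: "'a::field ^ 'n ^ 'n \<Rightarrow> 'a \<Rightarrow> bool" where
  "eigenvalue A c \<longleftrightarrow> (\<exists>v. v \<noteq> 0 \<and> A *v v = c *s v)"

definition diagonalizable :: "'a::field ^ 'n ^ 'n \<Rightarrow> bool" where
  "diagonalizable A \<longleftrightarrow>
     (\<exists>P D :: 'a ^ 'n ^ 'n.
        invertible P \<and> (\<forall>i j. i \<noteq> j \<longrightarrow> D $ i $ j = 0) \<and> A = P ** D ** matrix_inv P)"

definition complexify :: "real ^ 'n ^ 'n \<Rightarrow> complex ^ 'n ^ 'n" where
  "complexify A = map_matrix complex_of_real A"

section \<open>Phase space\<close>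

text \<open>
  The phase space of the variables \<open>z = (p, q)\<close> is \<open>real ^ (2 + 2)\<close>, whose index type is a
  disjoint sum: the indices \<open>Inl i\<close> carry the momentum and the indices \<open>Inr i\<close> the position.
  The singular set \<open>q = 0\<close> is not excluded from the type; the trajectories considered below
  avoid it.
\<close>

definition pair_vec :: "'a ^ 'n \<Rightarrow> 'a ^ 'm \<Rightarrow> 'a ^ ('n::finite + 'm::finite)" where
  "pair_vec p q = (\<chi> k. case k of Inl i \<Rightarrow> p $ i | Inr i \<Rightarrow> q $ i)"

definition momentum :: "'a ^ ('n::finite + 'm::finite) \<Rightarrow> 'a ^ 'n" where
  "momentum z = (\<chi> i. z $ Inl i)"

definition position :: "'a ^ ('n::finite + 'm::finite) \<Rightarrow> 'a ^ 'm" where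
  "position z = (\<chi> i. z $ Inr i)"

definition block_matrix ::
  "'a ^ 'n ^ 'k \<Rightarrow> 'a ^ 'm ^ 'k \<Rightarrow> 'a ^ 'n ^ 'l \<Rightarrow> 'a ^ 'm ^ 'l
     \<Rightarrow> 'a ^ ('n::finite + 'm::finite) ^ ('k::finite + 'l::finite)" where
  "block_matrix A B C D =
     (\<chi> i. case i of Inl r \<Rightarrow> pair_vec (A $ r) (B $ r) | Inr r \<Rightarrow> pair_vec (C $ r) (D $ r))"

definition symplectic_J :: "real ^ (2 + 2) ^ (2 + 2)" where
  "symplectic_J = block_matrix 0 (- mat 1) (mat 1) 0"

definition gradient :: "(real ^ 'n \<Rightarrow> real) \<Rightarrow> real ^ 'n \<Rightarrow> real ^ 'n" where
  "gradient f z = (THE D. GDERIV f z :> D)"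

definition hessian :: "(real ^ 'n \<Rightarrow> real) \<Rightarrow> real ^ 'n \<Rightarrow> real ^ 'n ^ 'n" where
  "hessian f z = jacobian (gradient f) (at z)"

section \<open>The Kepler problem\<close>

definition kepler_hamiltonian :: "real \<Rightarrow> real \<Rightarrow> real ^ (2 + 2) \<Rightarrow> real" where
  "kepler_hamiltonian \<mu> m z = (norm (momentum z))\<^sup>2 / (2 * \<mu>) - m / norm (position z)"

definition velocity :: "(real \<Rightarrow> real ^ 2) \<Rightarrow> real \<Rightarrow> real ^ 2" where
  "velocity \<gamma> t = vector_derivative \<gamma> (at t)"

definition kepler_solution :: "real \<Rightarrow> real \<Rightarrow> (real \<Rightarrow> real ^ 2) \<Rightarrow> bool" where
  "kepler_solution \<mu> m \<gamma> \<longleftrightarrow>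
     (\<forall>t. \<gamma> t \<noteq> 0 \<and> \<gamma> differentiable (at t) \<and> velocity \<gamma> differentiable (at t) \<and>
          \<mu> *\<^sub>R vector_derivative (velocity \<gamma>) (at t) = - (m / norm (\<gamma> t) ^ 3) *\<^sub>R \<gamma> t)"

definition prime_period :: "(real \<Rightarrow> 'a) \<Rightarrow> real \<Rightarrow> bool" where
  "prime_period \<gamma> T \<longleftrightarrow>
     T > 0 \<and> (\<forall>t. \<gamma> (t + T) = \<gamma> t) \<and> (\<forall>S. 0 < S \<and> S < T \<longrightarrow> (\<exists>t. \<gamma> (t + S) \<noteq> \<gamma> t))"

definition keplerian_ellipse :: "real \<Rightarrow> real \<Rightarrow> (real \<Rightarrow> real ^ 2) \<Rightarrow> real \<Rightarrow> bool" where
  "keplerian_ellipse \<mu> m \<gamma> T \<longleftrightarrow> kepler_solution \<mu> m \<gamma> \<and> prime_period \<gamma> T"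

definition phase_curve :: "real \<Rightarrow> (real \<Rightarrow> real ^ 2) \<Rightarrow> real \<Rightarrow> real ^ (2 + 2)" where
  "phase_curve \<mu> \<gamma> t = pair_vec (\<mu> *\<^sub>R velocity \<gamma> t) (\<gamma> t)"

section \<open>Monodromy and stability\<close>

definition is_fundamental_solution ::
  "real \<Rightarrow> real \<Rightarrow> (real \<Rightarrow> real ^ 2) \<Rightarrow> (real \<Rightarrow> real ^ (2 + 2) ^ (2 + 2)) \<Rightarrow> bool" where
  "is_fundamental_solution \<mu> m \<gamma> \<phi> \<longleftrightarrow>
     \<phi> 0 = mat 1 \<and>
     (\<forall>t. (\<phi> has_vector_derivative
             (symplectic_J ** hessian (kepler_hamiltonian \<mu> m) (phase_curve \<mu> \<gamma> t) ** \<phi> t)) (at t))"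

text \<open>
  For a solution of the Kepler equation on the whole line the linear system has exactly one
  solution with \<open>\<phi> 0 = mat 1\<close>, so the description below is proper.
\<close>

definition fundamental_solution ::
  "real \<Rightarrow> real \<Rightarrow> (real \<Rightarrow> real ^ 2) \<Rightarrow> real \<Rightarrow> real ^ (2 + 2) ^ (2 + 2)" where
  "fundamental_solution \<mu> m \<gamma> = (THE \<phi>. is_fundamental_solution \<mu> m \<gamma> \<phi>)"

definition monodromy_matrix ::
  "real \<Rightarrow> real \<Rightarrow> (real \<Rightarrow> real ^ 2) \<Rightarrow> real \<Rightarrow> real ^ (2 + 2) ^ (2 + 2)" where
  "monodromy_matrix \<mu> m \<gamma> T = fundamental_solution \<mu> m \<gamma> T"

definition elliptic :: "real \<Rightarrow> real \<Rightarrow> (real \<Rightarrow> real ^ 2) \<Rightarrow> real \<Rightarrow> bool" where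
  "elliptic \<mu> m \<gamma> T \<longleftrightarrow>
     {c. eigenvalue (complexify (monodromy_matrix \<mu> m \<gamma> T)) c} \<subseteq> sphere 0 1"

text \<open>Ellipticity and spectral stability are the same condition on the monodromy matrix.\<close>

definition spectrally_stable :: "real \<Rightarrow> real \<Rightarrow> (real \<Rightarrow> real ^ 2) \<Rightarrow> real \<Rightarrow> bool" where
  "spectrally_stable \<mu> m \<gamma> T \<longleftrightarrow>
     {c. eigenvalue (complexify (monodromy_matrix \<mu> m \<gamma> T)) c} \<subseteq> sphere 0 1"

definition linearly_stable :: "real \<Rightarrow> real \<Rightarrow> (real \<Rightarrow> real ^ 2) \<Rightarrow> real \<Rightarrow> bool" where
  "linearly_stable \<mu> m \<gamma> T \<longleftrightarrow>
     spectrally_stable \<mu> m \<gamma> T \<and> diagonalizable (complexify (monodromy_matrix \<mu> m \<gamma> T))"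

end

theory Submission
  imports Defs
begin

text \<open>
  Let \<open>M\<close> be the monodromy matrix and \<open>dz\<close> the velocity of the orbit in phase space. Variational
  solutions conserve the linearised first integrals, that is, the differentials along the orbit of
  the angular momentum and of the Laplace--Runge--Lenz vector. These integrals are periodic along
  the orbit, so the differentials vanish on \<open>M v - v\<close> for every \<open>v\<close>; since the angular momentum of a
  periodic orbit is nonzero, they have rank 3 and their common kernel is spanned by \<open>dz 0\<close>. As
  \<open>dz\<close> is a periodic variational solution, \<open>M\<close> fixes \<open>dz 0\<close>, hence \<open>(M - 1)\<^sup>2 = 0\<close> and 1 is the only
  eigenvalue. The scaling symmetry of the Kepler problem yields the variational solution
  \<open>(-p, 2q) - 3t dz\<close>, which is not periodic, so \<open>M \<noteq> 1\<close> and \<open>M\<close> is not diagonalizable.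
\<close>

section \<open>Linear differential equations\<close>

text \<open>Fundamental theorem of calculus on the whole line. The integral is based at 0 and
  changes sign for negative \<open>t\<close>; on a bounded interval it differs by a constant from
  the integral based at the left end.\<close>

lemma continuous_antiderivative:
  fixes f :: "real \<Rightarrow> 'a::banach"
  assumes f: "continuous_on UNIV f"
  shows "\<exists>F. F 0 = 0 \<and> (\<forall>t. (F has_vector_derivative f t) (at t))"
proof -
  define F where "F t = (if 0 \<le> t then integral {0..t} f else - integral {t..0} f)" for t
  have int: "f integrable_on {a..b}" for a b
    by (rule integrable_continuous_real) (rule continuous_on_subset[OF f], simp)
  have F: "F t = integral {-r..t} f - integral {-r..0} f" if "-r < t" "0 < r" for r t
  proof (cases "0 \<le> t")
    case True
    then show ?thesis
      using Henstock_Kurzweil_Integration.integral_combine[of "-r" 0 t f] int that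
      by (simp add: F_def algebra_simps)
  next
    case False
    then show ?thesis
      using Henstock_Kurzweil_Integration.integral_combine[of "-r" t 0 f] int that
      by (simp add: F_def algebra_simps)
  qed
  have "(F has_vector_derivative f t) (at t)" for t
  proof -
    \<comment> \<open>This radius makes \<open>t\<close> interior, so the derivative within the
      closed interval becomes two-sided.\<close>
    define r where "r = \<bar>t\<bar> + 1"
    have r: "0 < r" "t \<in> {-r<..<r}" by (auto simp: r_def)
    have "((\<lambda>u. integral {-r..u} f) has_vector_derivative f t) (at t within {-r..r})"
      by (rule integral_has_vector_derivative) (use r continuous_on_subset[OF f] in auto)
    then have "((\<lambda>u. integral {-r..u} f) has_vector_derivative f t) (at t within {-r<..<r})"
      by (rule has_vector_derivative_within_subset) auto
    then have "((\<lambda>u. integral {-r..u} f) has_vector_derivative f t) (at t)"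
      using r by (simp add: at_within_open[of _ "{-r<..<r}"])
    then have "((\<lambda>u. integral {-r..u} f - integral {-r..0} f) has_vector_derivative f t) (at t)"
      by (auto intro!: derivative_eq_intros)
    then show ?thesis
      by (rule has_vector_derivative_transform_within_open[where S = "{-r<..<r}"])
        (use r F[of r] in auto)
  qed
  moreover have "F 0 = 0" by (simp add: F_def)
  ultimately show ?thesis by blast
qed

text \<open>Induction step for factorial bounds on iterated integrals: each integration gains a
  factor \<open>|t| / Suc n\<close>. The mean value inequality against the majorant
  \<open>C * t ^ Suc n / Suc n\<close> settles positive times, reflection the negative ones.\<close>

lemma norm_antiderivative_power_bound:
  fixes F :: "real \<Rightarrow> 'a::real_normed_vector"
  assumes F0: "F 0 = 0" and F: "\<And>t. (F has_vector_derivative f t) (at t)"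
    and f: "\<And>t. \<bar>t\<bar> \<le> R \<Longrightarrow> norm (f t) \<le> C * \<bar>t\<bar> ^ n" and t: "\<bar>t\<bar> \<le> R"
  shows "norm (F t) \<le> C * \<bar>t\<bar> ^ Suc n / Suc n"
proof -
  have nonneg: "norm (G t) \<le> C * t ^ Suc n / Suc n"
    if "G 0 = 0" and G: "\<And>t. (G has_vector_derivative g t) (at t)"
      and g: "\<And>t. \<bar>t\<bar> \<le> R \<Longrightarrow> norm (g t) \<le> C * \<bar>t\<bar> ^ n" and t: "0 < t" "t \<le> R"
    for G g :: "real \<Rightarrow> 'a" and t
  proof -
    have "norm (G t - G 0) \<le> C * t ^ Suc n / Suc n - C * 0 ^ Suc n / Suc n"
    proof (rule differentiable_bound_general[where f = G and f' = g
        and \<phi> = "\<lambda>t. C * t ^ Suc n / Suc n" and \<phi>' = "\<lambda>t. C * t ^ n"])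
      show "continuous_on {0..t} G"
        by (meson G continuous_at_imp_continuous_on has_vector_derivative_continuous)
      show "continuous_on {0..t} (\<lambda>t. C * t ^ Suc n / real (Suc n))"
        by (intro continuous_intros) simp
      show "((\<lambda>t. C * t ^ Suc n / real (Suc n)) has_vector_derivative C * x ^ n) (at x)" for x
        unfolding has_real_derivative_iff_has_vector_derivative[symmetric]
        by (rule derivative_eq_intros refl)+ (simp_all add: divide_simps del: of_nat_Suc)
      show "norm (g x) \<le> C * x ^ n" if "0 < x" "x < t" for x
        using g[of x] that t by simp
    qed (use t G in auto)
    with that(1) show ?thesis by simp
  qed
  consider "t = 0" | "0 < t" | "t < 0" by linarith
  then show ?thesis
  proof cases
    case 1
    then show ?thesis by (simp add: F0)
  next
    case 2
    then show ?thesis using nonneg[of F f t, OF F0 F f] t by simp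
  next
    case 3
    have "((\<lambda>t. F (- t)) has_vector_derivative - f (- t)) (at t)" for t
      using vector_diff_chain_at[where f = uminus and f' = "-1" and g = F and x = t, OF _ F]
      by (simp add: o_def has_vector_derivative_minus[OF has_vector_derivative_id, unfolded id_def])
    moreover have "norm (- f (- s)) \<le> C * \<bar>s\<bar> ^ n" if "\<bar>s\<bar> \<le> R" for s
      using f[of "- s"] that by simp
    ultimately show ?thesis
      using nonneg[of "\<lambda>t. F (- t)" "\<lambda>t. - f (- t)" "- t"] 3 t F0 by simp
  qed
qed

text \<open>Peano--Baker series.\<close>

lemma linear_ode_exists:
  fixes prod :: "'a::real_normed_vector \<Rightarrow> 'b::banach \<Rightarrow> 'b" and A :: "real \<Rightarrow> 'a"
  assumes prod: "bounded_bilinear prod" and A: "continuous_on UNIV A"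
  shows "\<exists>x. x 0 = x\<^sub>0 \<and> (\<forall>t. (x has_vector_derivative prod (A t) (x t)) (at t))"
proof -
  interpret prod: bounded_bilinear prod by (rule prod)
  define anti where
    "anti f = (SOME F :: real \<Rightarrow> 'b. F 0 = 0 \<and> (\<forall>t. (F has_vector_derivative f t) (at t)))" for f
  have anti: "anti f 0 = 0" "(anti f has_vector_derivative f t) (at t)"
    if "continuous_on UNIV f" for f t
    using someI_ex[OF continuous_antiderivative[OF that]] by (auto simp: anti_def)
  \<comment> \<open>\<open>X n\<close> is the n-th iterated integral. \<open>X'\<close> lists the
    derivatives: 0 for the constant term, and an index shift for all later terms.\<close>
  define X where "X = rec_nat (\<lambda>t. x\<^sub>0) (\<lambda>_ f. anti (\<lambda>s. prod (A s) (f s)))"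
  define X' where "X' n t = (case n of 0 \<Rightarrow> 0 | Suc k \<Rightarrow> prod (A t) (X k t))" for n t
  have X0: "X 0 = (\<lambda>t. x\<^sub>0)" and XS: "X (Suc n) = anti (\<lambda>s. prod (A s) (X n s))" for n
    by (simp_all add: X_def)
  have contX: "continuous_on UNIV (X n)" for n
  proof (induction n)
    case (Suc n)
    have "continuous_on UNIV (\<lambda>s. prod (A s) (X n s))"
      by (rule prod.continuous_on[OF A Suc])
    from anti(2)[OF this] show ?case unfolding XS
      by (meson continuous_at_imp_continuous_on has_vector_derivative_continuous)
  qed (simp add: X0)
  have cont: "continuous_on UNIV (\<lambda>s. prod (A s) (X n s))" for n
    by (rule prod.continuous_on[OF A contX])
  have dX: "(X n has_vector_derivative X' n t) (at t)" for n t
    by (cases n) (auto simp: X0 XS X'_def intro: anti(2)[OF cont])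
  obtain B where B: "0 < B" "\<And>a b. norm (prod a b) \<le> norm a * norm b * B"
    using prod.pos_bounded by blast
  \<comment> \<open>The same constant \<open>K\<close> bounds the action of \<open>A t\<close> and
    the terms, so on [-R, R] the series is dominated by the one for
    \<open>norm x\<^sub>0 * exp (K * R)\<close>.\<close>
  have bound: "\<exists>K\<ge>0. \<forall>t. \<bar>t\<bar> \<le> R \<longrightarrow> (\<forall>b. norm (prod (A t) b) \<le> K * norm b) \<and>
      (\<forall>n. norm (X n t) \<le> norm x\<^sub>0 * K ^ n / fact n * \<bar>t\<bar> ^ n)" for R
  proof -
    have "compact (A ` {-R..R})"
      by (rule compact_continuous_image[OF continuous_on_subset[OF A]]) auto
    then obtain a where "0 < a" and a: "\<forall>t\<in>{-R..R}. norm (A t) \<le> a"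
      using compact_imp_bounded bounded_pos by (metis image_eqI)
    define K where "K = a * B"
    have K: "norm (prod (A t) b) \<le> K * norm b" if "\<bar>t\<bar> \<le> R" for t b
    proof -
      have "norm (prod (A t) b) \<le> norm (A t) * norm b * B" by (rule B)
      also have "\<dots> \<le> a * norm b * B"
        using a that B(1) by (intro mult_right_mono) (auto simp: abs_le_iff)
      finally show ?thesis by (simp add: K_def mult_ac)
    qed
    have "norm (X n t) \<le> norm x\<^sub>0 * K ^ n / fact n * \<bar>t\<bar> ^ n" if "\<bar>t\<bar> \<le> R" for n t
      using that
    proof (induction n arbitrary: t)
      case 0
      show ?case by (simp add: X0)
    next
      case (Suc n)
      have "norm (X (Suc n) t) \<le> (norm x\<^sub>0 * K ^ Suc n / fact n) * \<bar>t\<bar> ^ Suc n / Suc n"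
      proof (rule norm_antiderivative_power_bound[OF _ dX _ Suc.prems])
        show "X (Suc n) 0 = 0" unfolding XS by (rule anti(1)[OF cont])
        show "norm (X' (Suc n) s) \<le> norm x\<^sub>0 * K ^ Suc n / fact n * \<bar>s\<bar> ^ n" if "\<bar>s\<bar> \<le> R" for s
        proof -
          have "norm (X' (Suc n) s) \<le> K * norm (X n s)" by (simp add: X'_def K that)
          also have "\<dots> \<le> K * (norm x\<^sub>0 * K ^ n / fact n * \<bar>s\<bar> ^ n)"
            using Suc.IH[OF that] \<open>0 < a\<close> B(1) by (intro mult_left_mono) (auto simp: K_def)
          finally show ?thesis by (simp add: mult_ac)
        qed
      qed
      then show ?case by (simp add: field_simps)
    qed
    with K show ?thesis using \<open>0 < a\<close> B(1) by (intro exI[of _ K]) (auto simp: K_def)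
  qed
  define x where "x t = (\<Sum>n. X n t)" for t
  have sumM: "summable (\<lambda>n. c * K ^ n / fact n * r ^ n)" for c K r :: real
    using summable_mult[OF summable_exp[of "K * r"], of c]
    by (simp add: power_mult_distrib field_simps)
  have summ: "summable (\<lambda>n. X n t)" for t
  proof -
    obtain K where "\<forall>n. norm (X n t) \<le> norm x\<^sub>0 * K ^ n / fact n * \<bar>t\<bar> ^ n"
      using bound[of "\<bar>t\<bar>"] by blast
    then show ?thesis by (intro summable_comparison_test[OF _ sumM]) blast
  qed
  have dx: "(x has_vector_derivative prod (A t) (x t)) (at t)" for t
  proof -
    define R where "R = \<bar>t\<bar> + 1"
    define S where "S = {-R<..<R}"
    have t: "t \<in> S" and "open S" by (auto simp: S_def R_def)
    obtain K where "0 \<le> K" and K: "\<And>s b. \<bar>s\<bar> \<le> R \<Longrightarrow> norm (prod (A s) b) \<le> K * norm b"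
      and KX: "\<And>s n. \<bar>s\<bar> \<le> R \<Longrightarrow> norm (X n s) \<le> norm x\<^sub>0 * K ^ n / fact n * \<bar>s\<bar> ^ n"
      using bound[of R] by blast
    define M where "M n = norm x\<^sub>0 * K ^ n / fact n * R ^ n" for n
    have KM: "norm (X n s) \<le> M n" if "\<bar>s\<bar> \<le> R" for n s
    proof -
      have "norm x\<^sub>0 * K ^ n / fact n * \<bar>s\<bar> ^ n \<le> M n" unfolding M_def
        using that \<open>0 \<le> K\<close> by (intro mult_left_mono power_mono) auto
      with KX[OF that] show ?thesis by (rule order_trans)
    qed
    \<comment> \<open>Since \<open>X' 0 s = 0\<close>, shifting the index turns the series of
      derivatives into the image of the original series under \<open>prod (A s)\<close>.\<close>
    have sums': "(\<lambda>n. X' n s) sums prod (A s) (x s)" for s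
    proof -
      have "(\<lambda>n. prod (A s) (X n s)) sums prod (A s) (x s)"
        unfolding x_def
        by (rule bounded_linear.sums[OF prod.bounded_linear_right summable_sums[OF summ]])
      then show ?thesis using sums_Suc_iff[of "\<lambda>n. X' n s" "prod (A s) (x s)"]
        by (simp add: X'_def)
    qed
    \<comment> \<open>Termwise differentiation needs uniform convergence of the derivatives; the
      majorant carries the same index shift.\<close>
    have "uniform_limit S (\<lambda>n s. \<Sum>i<n. X' i s) (\<lambda>s. \<Sum>i. X' i s) sequentially"
    proof (rule Weierstrass_m_test)
      show "norm (X' n s) \<le> (case n of 0 \<Rightarrow> 0 | Suc k \<Rightarrow> K * M k)" if "s \<in> S" for n s
      proof -
        have s: "\<bar>s\<bar> \<le> R" using that by (auto simp: S_def)
        show ?thesis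
        proof (cases n)
          case (Suc k)
          then have "norm (X' n s) \<le> K * norm (X k s)" by (simp add: X'_def K[OF s])
          also have "\<dots> \<le> K * M k" by (rule mult_left_mono[OF KM[OF s] \<open>0 \<le> K\<close>])
          finally show ?thesis by (simp add: Suc)
        qed (simp add: X'_def)
      qed
      show "summable (\<lambda>n. case n of 0 \<Rightarrow> 0 | Suc k \<Rightarrow> K * M k)"
        unfolding M_def
        by (rule summable_Suc_iff[THEN iffD1], simp only: nat.case) (rule summable_mult[OF sumM])
    qed
    then have unif: "uniform_limit S (\<lambda>n s. \<Sum>i<n. X' i s) (\<lambda>s. prod (A s) (x s)) sequentially"
      by (simp only: sums_unique[OF sums'])
    have "\<exists>g. \<forall>s\<in>S. (\<lambda>n. X n s) sums g s \<and>
        (g has_derivative (\<lambda>h. h *\<^sub>R prod (A s) (x s))) (at s within S)"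
    proof (rule has_derivative_series[where f = X and f' = "\<lambda>n s h. h *\<^sub>R X' n s"])
      show "convex S" by (simp add: S_def)
      show "(X n has_derivative (\<lambda>h. h *\<^sub>R X' n s)) (at s within S)" for n s
        using dX[of n s] has_vector_derivative_at_within unfolding has_vector_derivative_def
        using has_derivative_at_withinI by blast
      show "\<forall>\<^sub>F n in sequentially. \<forall>s\<in>S. \<forall>h. norm ((\<Sum>i<n. h *\<^sub>R X' i s) - h *\<^sub>R prod (A s) (x s))
          \<le> e * norm h" if "0 < e" for e
        using uniform_limitD[OF unif that]
      proof eventually_elim
        case (elim n)
        show ?case
        proof (intro ballI allI)
          fix s h assume "s \<in> S"
          have "norm ((\<Sum>i<n. h *\<^sub>R X' i s) - h *\<^sub>R prod (A s) (x s))
              = norm h * dist (\<Sum>i<n. X' i s) (prod (A s) (x s))"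
          proof -
            have "(\<Sum>i<n. h *\<^sub>R X' i s) - h *\<^sub>R prod (A s) (x s)
                = h *\<^sub>R ((\<Sum>i<n. X' i s) - prod (A s) (x s))"
              by (simp only: scaleR_sum_right scaleR_diff_right)
            then show ?thesis by (simp only: dist_norm norm_scaleR real_norm_def)
          qed
          also have "\<dots> \<le> norm h * e" using elim \<open>s \<in> S\<close> by (intro mult_left_mono) auto
          finally show "norm ((\<Sum>i<n. h *\<^sub>R X' i s) - h *\<^sub>R prod (A s) (x s)) \<le> e * norm h"
            by (simp add: mult_ac)
        qed
      qed
      show "(\<lambda>n. X n t) sums x t" unfolding x_def by (rule summable_sums[OF summ])
    qed (rule t)
    then obtain g where g: "\<forall>s\<in>S. (\<lambda>n. X n s) sums g s \<and>
        (g has_derivative (\<lambda>h. h *\<^sub>R prod (A s) (x s))) (at s within S)"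
      by blast
    then have "(g has_vector_derivative prod (A t) (x t)) (at t within S)"
      using t by (simp add: has_vector_derivative_def)
    then have "(g has_vector_derivative prod (A t) (x t)) (at t)"
      by (simp only: at_within_open[OF t \<open>open S\<close>])
    then show ?thesis
    proof (rule has_vector_derivative_transform_within_open)
      show "open S" by fact
      show "g s = x s" if "s \<in> S" for s
        using g that unfolding x_def by (intro sums_unique) blast
    qed (rule t)
  qed
  \<comment> \<open>Iterated integrals vanish at time 0, so only the constant term contributes to
    the initial value.\<close>
  have "X n 0 = 0" if "n > 0" for n
    using that by (cases n) (auto simp: XS anti(1)[OF cont])
  then have "(\<Sum>n. X n 0) = (\<Sum>n\<in>{0}. X n 0)"
    by (intro suminf_finite) auto
  then have "x 0 = x\<^sub>0" unfolding x_def by (simp add: X0)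
  with dx show ?thesis by blast
qed

section \<open>Matrix linear systems and uniqueness of their solutions\<close>

lemma bounded_bilinear_matrix_mult:
  "bounded_bilinear ((**) :: real^'n^'m \<Rightarrow> real^'p^'n \<Rightarrow> real^'p^'m)"
  unfolding bilinear_conv_bounded_bilinear[symmetric] bilinear_def
  by (auto intro!: linearI simp: vec_eq_iff matrix_matrix_mult_def sum_distrib_left
      sum.distrib algebra_simps)

lemma bounded_bilinear_matrix_vector_mult:
  "bounded_bilinear ((*v) :: real^'n^'m \<Rightarrow> real^'n \<Rightarrow> real^'m)"
  unfolding bilinear_conv_bounded_bilinear[symmetric] bilinear_def
  by (auto intro!: linearI simp: vec_eq_iff matrix_vector_mult_def sum_distrib_left
      sum.distrib algebra_simps)

lemma (in bounded_bilinear) has_vector_derivative_prod: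
  assumes "(f has_vector_derivative f') (at t)" "(g has_vector_derivative g') (at t)"
  shows "((\<lambda>t. prod (f t) (g t)) has_vector_derivative prod (f t) g' + prod f' (g t)) (at t)"
  using FDERIV[OF assms[unfolded has_vector_derivative_def]]
  by (simp add: has_vector_derivative_def scaleR_left scaleR_right scaleR_add_right)

lemma fundamental_matrix_exists:
  fixes A :: "real \<Rightarrow> real^'n^'n"
  assumes "continuous_on UNIV A"
  shows "\<exists>\<phi>. \<phi> 0 = mat 1 \<and> (\<forall>t. (\<phi> has_vector_derivative A t ** \<phi> t) (at t))"
  by (rule linear_ode_exists[OF bounded_bilinear_matrix_mult assms])

text \<open>A left inverse of the fundamental matrix solves the adjoint system, whose existence
  therefore gives uniqueness for the original one.\<close>

lemma linear_system_solution:
  fixes A :: "real \<Rightarrow> real^'n^'n"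
  assumes A: "continuous_on UNIV A"
    and \<phi>: "\<phi> 0 = mat 1" "\<And>t. (\<phi> has_vector_derivative A t ** \<phi> t) (at t)"
    and y: "\<And>t. (y has_vector_derivative A t *v y t) (at t)"
  shows "y t = \<phi> t *v y 0"
proof -
  interpret mm: bounded_bilinear "(**) :: real^'n^'n \<Rightarrow> real^'n^'n \<Rightarrow> real^'n^'n"
    by (rule bounded_bilinear_matrix_mult)
  interpret mv: bounded_bilinear "(*v) :: real^'n^'n \<Rightarrow> real^'n \<Rightarrow> real^'n"
    by (rule bounded_bilinear_matrix_vector_mult)
  \<comment> \<open>Reversing the factors and the sign makes the general existence result yield the
    adjoint system.\<close>
  have "bounded_bilinear (\<lambda>(a :: real^'n^'n) (b :: real^'n^'n). - (b ** a))"
    unfolding bilinear_conv_bounded_bilinear[symmetric] bilinear_def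
    by (auto intro!: linearI simp: mm.add_left mm.add_right mm.scaleR_left mm.scaleR_right)
  from linear_ode_exists[OF this A, of "mat 1"]
  obtain \<psi> where \<psi>: "\<psi> 0 = mat 1" "\<And>t. (\<psi> has_vector_derivative - (\<psi> t ** A t)) (at t)"
    by blast
  have const: "f s = f 0" if "\<And>s. (f has_vector_derivative 0) (at s)"
    for f :: "real \<Rightarrow> 'b::real_normed_vector" and s
    by (rule has_vector_derivative_zero_constant[of UNIV f]) (use that in auto)
  have "((\<lambda>s. \<psi> s ** \<phi> s) has_vector_derivative 0) (at s)" for s
    using mm.has_vector_derivative_prod[OF \<psi>(2) \<phi>(2), of s]
    by (simp add: mm.minus_left matrix_mul_assoc)
  from const[OF this, of t] have "\<psi> t ** \<phi> t = mat 1" by (simp add: \<psi>(1) \<phi>(1))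
  \<comment> \<open>A left inverse of a square matrix is also a right inverse; this later allows
    solving for \<open>y t\<close>.\<close>
  then have inv: "\<phi> t ** \<psi> t = mat 1" by (simp add: matrix_left_right_inverse)
  have "((\<lambda>s. \<psi> s *v y s) has_vector_derivative 0) (at s)" for s
    using mv.has_vector_derivative_prod[OF \<psi>(2) y, of s]
    by (simp add: mv.minus_left matrix_vector_mul_assoc)
  from const[OF this, of t] have "\<psi> t *v y t = y 0" by (simp add: \<psi>(1))
  then have "\<phi> t *v y 0 = (\<phi> t ** \<psi> t) *v y t" by (simp add: matrix_vector_mul_assoc[symmetric])
  with inv show ?thesis by simp
qed

lemma fundamental_matrix_column:
  fixes A :: "real \<Rightarrow> real^'n^'n"
  assumes \<phi>: "\<And>t. (\<phi> has_vector_derivative A t ** \<phi> t) (at t)"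
  shows "((\<lambda>t. \<phi> t *v v) has_vector_derivative A t *v (\<phi> t *v v)) (at t)"
  using bounded_linear.has_vector_derivative[OF
      bounded_bilinear.bounded_linear_left[OF bounded_bilinear_matrix_vector_mult] \<phi>]
  by (simp add: matrix_vector_mul_assoc)

text \<open>Applied to any vector, both matrices give solutions with the same initial value.
  Together with existence this justifies the definite description in
  \<open>fundamental_solution\<close>.\<close>

lemma fundamental_matrix_unique:
  fixes A :: "real \<Rightarrow> real^'n^'n"
  assumes A: "continuous_on UNIV A"
    and \<phi>: "\<phi> 0 = mat 1" "\<And>t. (\<phi> has_vector_derivative A t ** \<phi> t) (at t)"
    and \<psi>: "\<psi> 0 = mat 1" "\<And>t. (\<psi> has_vector_derivative A t ** \<psi> t) (at t)"
  shows "\<psi> = \<phi>"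
proof
  fix t
  have "\<psi> t *v v = \<phi> t *v v" for v
    using linear_system_solution[OF A \<phi> fundamental_matrix_column[OF \<psi>(2)], of t v]
    by (simp add: \<psi>(1))
  then show "\<psi> t = \<phi> t" by (simp add: matrix_eq)
qed

section \<open>Unipotent matrices\<close>

lemma complexify_mult: "complexify (A ** B) = complexify A ** complexify B"
  by (simp add: complexify_def map_matrix_def matrix_matrix_mult_def vec_eq_iff)

lemma complexify_diff: "complexify (A - B) = complexify A - complexify B"
  by (simp add: complexify_def map_matrix_def vec_eq_iff)

lemma complexify_mat_1: "complexify (mat 1) = mat 1"
  by (simp add: complexify_def map_matrix_def mat_def vec_eq_iff)

lemma complexify_0: "complexify 0 = 0"
  by (simp add: complexify_def map_matrix_def vec_eq_iff)

lemma complexify_eq_iff: "complexify A = complexify B \<longleftrightarrow> A = B"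
  by (simp add: complexify_def map_matrix_def vec_eq_iff)

text \<open>On an eigenvector the square of \<open>A - mat 1\<close> acts as
  \<open>(c - 1) * (c - 1)\<close>, and a field has no zero divisors.\<close>

lemma eigenvalue_unipotent:
  fixes A :: "'a::field^'n^'n"
  assumes sq: "(A - mat 1) ** (A - mat 1) = 0" and c: "eigenvalue A c"
  shows "c = 1"
proof -
  obtain v where v: "v \<noteq> 0" "A *v v = c *s v" using c by (auto simp: eigenvalue_def)
  have N: "(A - mat 1) *v v = (c - 1) *s v"
    using v(2) by (simp add: matrix_vector_mult_diff_rdistrib vector_sub_rdistrib)
  have "0 = (A - mat 1) *v ((A - mat 1) *v v)"
    by (simp add: matrix_vector_mul_assoc sq)
  also have "\<dots> = ((c - 1) * (c - 1)) *s v"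
    by (simp only: N vector_scalar_commute vector_smult_assoc)
  finally show "c = 1" using v(1) by (simp add: vec.scale_eq_0_iff)
qed

text \<open>The columns of \<open>P\<close> are eigenvectors, so every diagonal entry of
  \<open>D\<close> is 1, and a conjugate of the identity is the identity.\<close>

lemma diagonalizable_unipotent:
  fixes A :: "'a::field^'n^'n"
  assumes sq: "(A - mat 1) ** (A - mat 1) = 0" and A: "diagonalizable A"
  shows "A = mat 1"
proof -
  obtain P D :: "'a^'n^'n" where P: "invertible P" and D: "\<And>i j. i \<noteq> j \<Longrightarrow> D $ i $ j = 0"
    and eq: "A = P ** D ** matrix_inv P"
    using A by (auto simp: diagonalizable_def)
  have PP: "P ** matrix_inv P = mat 1" "matrix_inv P ** P = mat 1"
    using someI_ex[OF P[unfolded invertible_def]] unfolding matrix_inv_def by blast+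
  have AP: "A ** P = P ** D"
    unfolding eq by (simp only: matrix_mul_assoc[symmetric] PP matrix_mul_rid)
  have col: "D *v axis i 1 = D $ i $ i *s axis i 1" for i
    using D by (auto simp: vec_eq_iff matrix_vector_mult_def axis_def if_distrib[of "\<lambda>x. _ * x"]
        cong: if_cong)
  have ev: "eigenvalue A (D $ i $ i)" for i
    unfolding eigenvalue_def
  proof (intro exI conjI)
    show "P *v axis i 1 \<noteq> 0"
    proof
      assume "P *v axis i 1 = 0"
      then have "(matrix_inv P ** P) *v axis i 1 = 0"
        by (simp add: matrix_vector_mul_assoc[symmetric])
      then show False by (simp add: PP)
    qed
    show "A *v (P *v axis i 1) = D $ i $ i *s (P *v axis i 1)"
      by (simp only: matrix_vector_mul_assoc AP)
        (simp only: matrix_vector_mul_assoc[symmetric] col vector_scalar_commute)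
  qed
  have "D = mat 1"
    using D eigenvalue_unipotent[OF sq ev] by (auto simp: vec_eq_iff mat_def)
  then show ?thesis by (simp add: eq PP)
qed

section \<open>The Kepler Hamiltonian\<close>

lemma sum_UNIV_Plus:
  "sum f (UNIV :: ('n::finite + 'm::finite) set) = (\<Sum>i\<in>UNIV. f (Inl i)) + (\<Sum>i\<in>UNIV. f (Inr i))"
  using sum.Plus[of "UNIV :: 'n set" "UNIV :: 'm set" f] by simp

lemma momentum_pair_vec [simp]: "momentum (pair_vec p q) = p"
  and position_pair_vec [simp]: "position (pair_vec p q) = q"
  and pair_vec_momentum_position [simp]: "pair_vec (momentum z) (position z) = z"
  by (auto simp: momentum_def position_def pair_vec_def vec_eq_iff split: sum.split)

lemma inner_pair_vec: "inner z (pair_vec p q) = inner (momentum z) p + inner (position z) q"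
  by (simp add: inner_vec_def sum_UNIV_Plus momentum_def position_def pair_vec_def)

lemma scaleR_pair_vec: "c *\<^sub>R pair_vec p q = pair_vec (c *\<^sub>R p) (c *\<^sub>R q)"
  by (auto simp: pair_vec_def vec_eq_iff split: sum.split)

lemma bounded_linear_momentum:
  "bounded_linear (momentum :: real^('n::finite + 'm::finite) \<Rightarrow> real^'n)"
  by (auto intro!: linearI simp: linear_conv_bounded_linear[symmetric] momentum_def vec_eq_iff)

lemma bounded_linear_position:
  "bounded_linear (position :: real^('n::finite + 'm::finite) \<Rightarrow> real^'m)"
  by (auto intro!: linearI simp: linear_conv_bounded_linear[symmetric] position_def vec_eq_iff)

lemma bounded_linear_pair_vec:
  "bounded_linear (\<lambda>x. pair_vec (fst x) (snd x) :: real^('n::finite + 'm::finite))"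
  by (auto intro!: linearI simp: linear_conv_bounded_linear[symmetric] pair_vec_def vec_eq_iff
      split: sum.split)

lemma has_derivative_pair_vec [derivative_intros]:
  fixes f :: "'a::real_normed_vector \<Rightarrow> real^'n::finite" and g :: "'a \<Rightarrow> real^'m::finite"
  assumes "(f has_derivative f') (at x within S)" "(g has_derivative g') (at x within S)"
  shows "((\<lambda>x. pair_vec (f x) (g x)) has_derivative (\<lambda>h. pair_vec (f' h) (g' h))) (at x within S)"
  using bounded_linear.has_derivative[OF bounded_linear_pair_vec has_derivative_Pair[OF assms]]
  by simp

lemma has_vector_derivative_pair_vec:
  fixes f :: "real \<Rightarrow> real^'n::finite" and g :: "real \<Rightarrow> real^'m::finite"
  assumes "(f has_vector_derivative f') (at x within S)"
    and "(g has_vector_derivative g') (at x within S)"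
  shows "((\<lambda>x. pair_vec (f x) (g x)) has_vector_derivative pair_vec f' g') (at x within S)"
  using has_derivative_pair_vec[OF assms[unfolded has_vector_derivative_def]]
  by (simp add: has_vector_derivative_def scaleR_pair_vec)

lemma symplectic_J_pair_vec: "symplectic_J *v pair_vec p q = pair_vec (- q) p"
  by (auto simp: symplectic_J_def block_matrix_def matrix_vector_mult_def sum_UNIV_Plus pair_vec_def
      vec_eq_iff mat_def sum_negf if_distrib[of "\<lambda>x. x * _"] if_distrib[of uminus]
      cong: if_cong split: sum.split)

lemmas has_derivative_momentum [derivative_intros] =
  bounded_linear.has_derivative[OF bounded_linear_momentum]
lemmas has_derivative_position [derivative_intros] =
  bounded_linear.has_derivative[OF bounded_linear_position]

section \<open>Gradient and Hessian of the Hamiltonian\<close>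

lemma gradient_eqI:
  assumes "GDERIV f z :> D"
  shows "gradient f z = D"
  unfolding gradient_def
proof (rule the_equality)
  fix D' assume "GDERIV f z :> D'"
  then have "(\<lambda>h. inner h D') = (\<lambda>h. inner h D)"
    using assms has_derivative_unique unfolding gderiv_def by blast
  then show "D' = D" by (metis inner_commute vector_eq_ldot)
qed (rule assms)

lemma has_derivative_inverse_norm_position:
  fixes z :: "real^('n::finite + 'm::finite)"
  assumes q: "position z \<noteq> 0"
  shows "((\<lambda>z. inverse (norm (position z :: real^'m))) has_derivative
    (\<lambda>h. - (inner (position z) (position h) / norm (position z) ^ 3))) (at z)"
proof -
  have "((\<lambda>z. norm (position z :: real^'m)) has_derivative
      (\<lambda>h. inner (position h) (sgn (position z)))) (at z)"
    by (rule has_derivative_compose[OF has_derivative_position[OF has_derivative_ident]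
          has_derivative_norm[OF q]])
  from Deriv.has_derivative_inverse[OF _ this] q show ?thesis
    by (simp add: sgn_div_norm inner_commute power3_eq_cube divide_inverse mult_ac)
qed

lemma gradient_kepler_hamiltonian:
  assumes q: "position z \<noteq> 0" and \<mu>: "\<mu> \<noteq> 0"
  shows "gradient (kepler_hamiltonian \<mu> m) z =
    pair_vec ((1 / \<mu>) *\<^sub>R momentum z) ((m / norm (position z) ^ 3) *\<^sub>R position z)"
proof (rule gradient_eqI)
  let ?G = "pair_vec ((1 / \<mu>) *\<^sub>R momentum z) ((m / norm (position z) ^ 3) *\<^sub>R position z)"
  have "((\<lambda>z :: real^(2+2). (1 / (2 * \<mu>)) * inner (momentum z) (momentum z)
        - m * inverse (norm (position z))) has_derivative
      (\<lambda>h. (1 / (2 * \<mu>)) * (inner (momentum z) (momentum h) + inner (momentum h) (momentum z))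
        - m * - (inner (position z) (position h) / norm (position z) ^ 3))) (at z)"
    by (rule has_derivative_diff[OF
          has_derivative_mult_right[OF
            has_derivative_inner[OF has_derivative_momentum has_derivative_momentum]]
          has_derivative_mult_right[OF has_derivative_inverse_norm_position[OF q]]];
        rule has_derivative_ident)
  moreover have "kepler_hamiltonian \<mu> m =
      (\<lambda>z. (1 / (2 * \<mu>)) * inner (momentum z) (momentum z) - m * inverse (norm (position z)))"
    by (simp add: fun_eq_iff kepler_hamiltonian_def dot_square_norm inverse_eq_divide)
  moreover have "(1 / (2 * \<mu>)) * (inner (momentum z) (momentum h) + inner (momentum h) (momentum z))
        - m * - (inner (position z) (position h) / norm (position z) ^ 3) = inner h ?G" for h
    using \<mu> by (simp add: inner_pair_vec inner_commute)
  ultimately show "GDERIV (kepler_hamiltonian \<mu> m) z :> ?G"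
    by (simp only: gderiv_def)
qed

text \<open>Closed form of D^2 H applied to \<open>h\<close>. The base point enters only through its
  position \<open>q\<close>, as the kinetic energy is quadratic; the last term comes from
  differentiating |q|^(-3).\<close>

definition kepler_hessian_apply :: "real \<Rightarrow> real \<Rightarrow> real^2 \<Rightarrow> real^(2+2) \<Rightarrow> real^(2+2)" where
  "kepler_hessian_apply \<mu> m q h = pair_vec ((1 / \<mu>) *\<^sub>R momentum h)
     ((m / norm q ^ 3) *\<^sub>R position h - (3 * m * inner q (position h) / norm q ^ 5) *\<^sub>R q)"

lemma has_derivative_gradient_kepler_hamiltonian:
  assumes q: "position z \<noteq> 0" and \<mu>: "\<mu> \<noteq> 0"
  shows "(gradient (kepler_hamiltonian \<mu> m) has_derivative
    kepler_hessian_apply \<mu> m (position z)) (at z)"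
proof -
  have "((\<lambda>z :: real^(2+2). pair_vec ((1 / \<mu>) *\<^sub>R momentum z)
        ((m * inverse (norm (position z)) ^ 3) *\<^sub>R position z)) has_derivative
      (\<lambda>h. pair_vec ((1 / \<mu>) *\<^sub>R momentum h)
        ((m * inverse (norm (position z)) ^ 3) *\<^sub>R position h
          + (m * (of_nat 3 * - (inner (position z) (position h) / norm (position z) ^ 3)
              * inverse (norm (position z)) ^ (3 - 1))) *\<^sub>R position z))) (at z)"
    by (intro has_derivative_pair_vec has_derivative_scaleR has_derivative_scaleR_right
        has_derivative_mult_right has_derivative_power
        has_derivative_inverse_norm_position q has_derivative_momentum has_derivative_position
        has_derivative_ident)
  moreover have "pair_vec ((1 / \<mu>) *\<^sub>R momentum h)
        ((m * inverse (norm (position z)) ^ 3) *\<^sub>R position h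
          + (m * (of_nat 3 * - (inner (position z) (position h) / norm (position z) ^ 3)
              * inverse (norm (position z)) ^ (3 - 1))) *\<^sub>R position z)
      = kepler_hessian_apply \<mu> m (position z) h" for h
    using q by (simp add: kepler_hessian_apply_def field_simps eval_nat_numeral)
  ultimately have "((\<lambda>z. pair_vec ((1 / \<mu>) *\<^sub>R momentum z)
        ((m * inverse (norm (position z)) ^ 3) *\<^sub>R position z))
      has_derivative kepler_hessian_apply \<mu> m (position z)) (at z)"
    by simp
  \<comment> \<open>The explicit gradient is available only off the singular set; openness makes it
    valid near \<open>z\<close>, which suffices for the derivative.\<close>
  moreover have "open {z :: real^(2+2). position z \<noteq> 0}"
    by (intro open_Collect_neq continuous_on_const
        bounded_linear.continuous_on[OF bounded_linear_position] continuous_on_id)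
  ultimately show ?thesis
    by (rule has_derivative_transform_within_open)
      (use q \<mu> in \<open>auto simp: gradient_kepler_hamiltonian power_inverse divide_inverse\<close>)
qed

lemma hessian_kepler_hamiltonian:
  assumes "position z \<noteq> 0" and "\<mu> \<noteq> 0"
  shows "hessian (kepler_hamiltonian \<mu> m) z *v h = kepler_hessian_apply \<mu> m (position z) h"
proof -
  have "(gradient (kepler_hamiltonian \<mu> m) has_derivative
      (\<lambda>h. hessian (kepler_hamiltonian \<mu> m) z *v h)) (at z)"
    unfolding hessian_def jacobian_works[symmetric]
    using has_derivative_gradient_kepler_hamiltonian[OF assms] by (rule differentiableI)
  then show ?thesis
    using has_derivative_gradient_kepler_hamiltonian[OF assms] has_derivative_unique by metis
qed

lemma symplectic_J_hessian:
  assumes "q \<noteq> 0" "\<mu> \<noteq> 0"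
  shows "(symplectic_J ** hessian (kepler_hamiltonian \<mu> m) (pair_vec p q)) *v pair_vec \<eta> \<xi> =
    pair_vec (- ((m / norm q ^ 3) *\<^sub>R \<xi> - (3 * m * inner q \<xi> / norm q ^ 5) *\<^sub>R q))
      ((1 / \<mu>) *\<^sub>R \<eta>)"
  using hessian_kepler_hamiltonian[of "pair_vec p q" \<mu> m "pair_vec \<eta> \<xi>"] assms
  by (simp add: matrix_vector_mul_assoc[symmetric] kepler_hessian_apply_def symplectic_J_pair_vec)

text \<open>Column \<open>j\<close> is the Hessian applied to \<open>axis j 1\<close>, an explicit
  expression that is continuous in the position away from 0. This yields the continuous coefficients
  that the linear theory asks for.\<close>

lemma continuous_hessian_kepler_hamiltonian:
  assumes z: "continuous_on S z" and nz: "\<And>t. t \<in> S \<Longrightarrow> position (z t) \<noteq> 0" and \<mu>: "\<mu> \<noteq> 0"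
  shows "continuous_on S (\<lambda>t. hessian (kepler_hamiltonian \<mu> m) (z t))"
proof -
  have "continuous_on S (\<lambda>t. \<chi> i j. kepler_hessian_apply \<mu> m (position (z t)) (axis j 1) $ i)"
  proof (intro continuous_on_vec_lambda continuous_on_component)
    fix j :: "2 + 2"
    have q: "continuous_on S (\<lambda>t. position (z t) :: real^2)"
      by (rule bounded_linear.continuous_on[OF bounded_linear_position z])
    have "continuous_on S (\<lambda>t. ((1 / \<mu>) *\<^sub>R momentum (axis j 1 :: real^(2+2)) :: real^2,
        (m / norm (position (z t)) ^ 3) *\<^sub>R position (axis j 1 :: real^(2+2))
          - (3 * m * inner (position (z t)) (position (axis j 1 :: real^(2+2)))
              / norm (position (z t)) ^ 5) *\<^sub>R position (z t) :: real^2))"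
      by (intro continuous_intros q) (use nz in auto)
    from bounded_linear.continuous_on[OF bounded_linear_pair_vec this]
    show "continuous_on S (\<lambda>t. kepler_hessian_apply \<mu> m (position (z t)) (axis j 1))"
      by (simp add: kepler_hessian_apply_def)
  qed
  moreover have "hessian (kepler_hamiltonian \<mu> m) (z t)
      = (\<chi> i j. kepler_hessian_apply \<mu> m (position (z t)) (axis j 1) $ i)" if "t \<in> S" for t
    using hessian_kepler_hamiltonian[OF nz[OF that] \<mu>, of m]
      matrix_of_matrix_vector_mul[of "hessian (kepler_hamiltonian \<mu> m) (z t)"]
    by (simp add: matrix_def)
  ultimately show ?thesis by (simp cong: continuous_on_cong)
qed

section \<open>First integrals in coordinates\<close>

lemma const_if_DERIV_0:
  fixes f :: "real \<Rightarrow> real"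
  assumes "\<And>t. (f has_real_derivative 0) (at t)"
  shows "f t = f 0"
  using DERIV_isconst_all[of f] assms by blast

text \<open>Kepler motion in scalar coordinates, with position (\<open>x\<close>, \<open>y\<close>),
  velocity (\<open>u\<close>, \<open>w\<close>) and, later, \<open>k = m / \<mu>\<close>. In this
  form the conservation laws reduce to polynomial identities.\<close>

locale planar_kepler =
  fixes k :: real and x y u w :: "real \<Rightarrow> real"
  assumes k_pos: "k > 0"
    and nonzero: "x t \<noteq> 0 \<or> y t \<noteq> 0"
    and dx: "(x has_real_derivative u t) (at t)"
    and dy: "(y has_real_derivative w t) (at t)"
    and du: "(u has_real_derivative - k * x t / sqrt ((x t)\<^sup>2 + (y t)\<^sup>2) ^ 3) (at t)"
    and dw: "(w has_real_derivative - k * y t / sqrt ((x t)\<^sup>2 + (y t)\<^sup>2) ^ 3) (at t)"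
begin

definition r :: "real \<Rightarrow> real" where "r t = sqrt ((x t)\<^sup>2 + (y t)\<^sup>2)"

definition L :: "real \<Rightarrow> real" where "L t = x t * w t - y t * u t"

lemma r_sq: "(r t)\<^sup>2 = (x t)\<^sup>2 + (y t)\<^sup>2"
  by (simp add: r_def)

lemma r_pos: "0 < r t"
  using nonzero[of t] by (simp add: r_def sum_power2_gt_zero_iff)

lemmas du' = du[folded r_def] and dw' = dw[folded r_def]

lemma dr: "(r has_real_derivative (x t * u t + y t * w t) / r t) (at t)"
proof -
  have "((\<lambda>t. (x t)\<^sup>2 + (y t)\<^sup>2) has_real_derivative 2 * (x t * u t + y t * w t)) (at t)"
    by (rule derivative_eq_intros dx dy refl)+ (simp add: algebra_simps)
  moreover have "(sqrt has_real_derivative inverse (r t) / 2) (at ((x t)\<^sup>2 + (y t)\<^sup>2))"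
    using DERIV_real_sqrt[of "(x t)\<^sup>2 + (y t)\<^sup>2"] nonzero[of t]
    by (simp add: r_def sum_power2_gt_zero_iff)
  ultimately have "((\<lambda>t. sqrt ((x t)\<^sup>2 + (y t)\<^sup>2)) has_real_derivative
      inverse (r t) / 2 * (2 * (x t * u t + y t * w t))) (at t)"
    by (rule DERIV_chain2[rotated])
  moreover have "inverse (r t) / 2 * (2 * (x t * u t + y t * w t)) = (x t * u t + y t * w t) / r t"
    by (simp add: divide_simps)
  ultimately show ?thesis by (simp only: r_def[abs_def])
qed

text \<open>The force is central, so it exerts no torque.\<close>

lemma L_const: "L t = L 0"
proof (rule const_if_DERIV_0)
  show "(L has_real_derivative 0) (at t)" for t
    unfolding L_def[abs_def]
    by (rule derivative_eq_intros dx dy du' dw' refl)+ (simp add: algebra_simps)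
qed

text \<open>These are the components of v x L - k q / r, with the constant \<open>L 0\<close>
  written for \<open>L t\<close>. Up to a factor k / r^3 the derivative is a polynomial that
  vanishes once r^2 is replaced by x^2 + y^2.\<close>

lemma LRL_const:
  "w t * L 0 - k * x t / r t = w 0 * L 0 - k * x 0 / r 0"
  "- u t * L 0 - k * y t / r t = - u 0 * L 0 - k * y 0 / r 0"
proof -
  have 1: "((\<lambda>t. w t * L 0 - k * x t / r t) has_real_derivative 0) (at t)" for t
  proof -
    have "((\<lambda>t. w t * L 0 - k * x t / r t) has_real_derivative
       (- k * y t / r t ^ 3) * L t
         - (k * u t * r t - k * x t * ((x t * u t + y t * w t) / r t)) / (r t * r t)) (at t)"
      using r_pos[of t]
      by (auto intro!: derivative_eq_intros dx dw' dr simp: L_const[of t])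
    moreover have "(- k * y t / r t ^ 3) * L t
         - (k * u t * r t - k * x t * ((x t * u t + y t * w t) / r t)) / (r t * r t)
       = - (k / r t ^ 3) * (y t * L t + u t * (r t)\<^sup>2 - x t * (x t * u t + y t * w t))"
      using r_pos[of t] by (simp add: field_simps power2_eq_square power3_eq_cube)
    moreover have "y t * L t + u t * (r t)\<^sup>2 - x t * (x t * u t + y t * w t) = 0"
      unfolding r_sq L_def by algebra
    ultimately show ?thesis by simp
  qed
  have 2: "((\<lambda>t. - u t * L 0 - k * y t / r t) has_real_derivative 0) (at t)" for t
  proof -
    have "((\<lambda>t. - u t * L 0 - k * y t / r t) has_real_derivative
       (k * x t / r t ^ 3) * L t
         - (k * w t * r t - k * y t * ((x t * u t + y t * w t) / r t)) / (r t * r t)) (at t)"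
      using r_pos[of t]
      by (auto intro!: derivative_eq_intros dy du' dr simp: L_const[of t])
    moreover have "(k * x t / r t ^ 3) * L t
         - (k * w t * r t - k * y t * ((x t * u t + y t * w t) / r t)) / (r t * r t)
       = (k / r t ^ 3) * (x t * L t - w t * (r t)\<^sup>2 + y t * (x t * u t + y t * w t))"
      using r_pos[of t] by (simp add: field_simps power2_eq_square power3_eq_cube)
    moreover have "x t * L t - w t * (r t)\<^sup>2 + y t * (x t * u t + y t * w t) = 0"
      unfolding r_sq L_def by algebra
    ultimately show ?thesis by simp
  qed
  show "w t * L 0 - k * x t / r t = w 0 * L 0 - k * x 0 / r 0"
    by (rule const_if_DERIV_0[OF 1])
  show "- u t * L 0 - k * y t / r t = - u 0 * L 0 - k * y 0 / r 0"
    by (rule const_if_DERIV_0[OF 2])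
qed

text \<open>With zero angular momentum the Laplace--Runge--Lenz vector fixes the direction of the
  position, and the radial velocity is strictly decreasing.\<close>

lemma L_nonzero:
  assumes T: "T > 0" "u T = u 0" "w T = w 0"
  shows "L 0 \<noteq> 0"
proof
  assume L0: "L 0 = 0"
  have dir: "x t = x 0 / r 0 * r t" "y t = y 0 / r 0 * r t" for t
    using LRL_const[of t] k_pos r_pos[of t] r_pos[of 0] by (auto simp: L0 field_simps)
  \<comment> \<open>Velocity component along the fixed direction; its derivative simplifies to -k /
    r^2.\<close>
  define f where "f t = u t * (x 0 / r 0) + w t * (y 0 / r 0)" for t
  have "f T < f 0"
  proof (rule DERIV_neg_imp_decreasing[OF T(1)])
    fix t
    have "(f has_real_derivative
        - k * x t / r t ^ 3 * (x 0 / r 0) + - k * y t / r t ^ 3 * (y 0 / r 0)) (at t)"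
      unfolding f_def[abs_def] by (intro DERIV_add DERIV_cmult_right du' dw')
    moreover have "- k * x t / r t ^ 3 * (x 0 / r 0) + - k * y t / r t ^ 3 * (y 0 / r 0)
        = - (k / r t ^ 3) * (x t * (x 0 / r 0) + y t * (y 0 / r 0))"
      by (simp add: algebra_simps)
    moreover have "x t * (x 0 / r 0) + y t * (y 0 / r 0) = r t"
    proof -
      have "x t * (x 0 / r 0) + y t * (y 0 / r 0) = r t * (((x 0)\<^sup>2 + (y 0)\<^sup>2) / (r 0)\<^sup>2)"
        using r_pos[of 0] by (subst (1) dir(1)[of t], subst (1) dir(2)[of t])
          (simp add: field_simps power2_eq_square)
      then show ?thesis using r_pos[of 0] by (simp add: r_sq[symmetric])
    qed
    moreover have "- (k / r t ^ 3) * r t < 0" using k_pos r_pos[of t] by simp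
    ultimately show "\<exists>z. (f has_real_derivative z) (at t) \<and> z < 0" by auto
  qed
  then show False by (simp add: f_def T)
qed

end

text \<open>First-order variations (\<open>X\<close>, \<open>Y\<close>) of the position and
  (\<open>U\<close>, \<open>W\<close>) of the velocity. The equations differentiate the inverse
  square law along the orbit; the fifth powers come from the derivative of r^(-3).\<close>

locale planar_kepler_variation = planar_kepler +
  fixes X Y U W :: "real \<Rightarrow> real"
  assumes dX: "(X has_real_derivative U t) (at t)"
    and dY: "(Y has_real_derivative W t) (at t)"
    and dU: "(U has_real_derivative - k * X t / sqrt ((x t)\<^sup>2 + (y t)\<^sup>2) ^ 3
      + 3 * k * (x t * X t + y t * Y t) * x t / sqrt ((x t)\<^sup>2 + (y t)\<^sup>2) ^ 5) (at t)"
    and dW: "(W has_real_derivative - k * Y t / sqrt ((x t)\<^sup>2 + (y t)\<^sup>2) ^ 3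
      + 3 * k * (x t * X t + y t * Y t) * y t / sqrt ((x t)\<^sup>2 + (y t)\<^sup>2) ^ 5) (at t)"
begin

lemmas dU' = dU[folded r_def] and dW' = dW[folded r_def]

text \<open>The quantity \<open>dL\<close> and the ones in \<open>dLRL_const\<close> below are the linearisations of the angular
  momentum \<open>L\<close> and of the Laplace--Runge--Lenz vector in \<open>LRL_const\<close>.\<close>

definition dL :: "real \<Rightarrow> real" where
  "dL t = X t * w t + x t * W t - Y t * u t - y t * U t"

text \<open>The terms over r^5 are parallel to the position and have no torque; those over r^3
  cancel between the varied position and the varied force.\<close>

lemma dL_const: "dL t = dL 0"
proof (rule const_if_DERIV_0)
  show "(dL has_real_derivative 0) (at t)" for t
    unfolding dL_def[abs_def]
    by (rule derivative_eq_intros dx dy du' dw' dX dY dU' dW' refl)+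
      (simp add: field_simps)
qed

lemma dLRL_const:
  "W t * L 0 + w t * dL 0 - k * y t * (y t * X t - x t * Y t) / r t ^ 3
    = W 0 * L 0 + w 0 * dL 0 - k * y 0 * (y 0 * X 0 - x 0 * Y 0) / r 0 ^ 3"
  "U t * L 0 + u t * dL 0 + k * x t * (x t * Y t - y t * X t) / r t ^ 3
    = U 0 * L 0 + u 0 * dL 0 + k * x 0 * (x 0 * Y 0 - y 0 * X 0) / r 0 ^ 3"
proof -
  have 1: "((\<lambda>t. W t * L 0 + w t * dL 0 - k * y t * (y t * X t - x t * Y t) / r t ^ 3)
      has_real_derivative 0) (at t)" for t
  proof -
    have "((\<lambda>t. W t * L 0 + w t * dL 0 - k * y t * (y t * X t - x t * Y t) / r t ^ 3)
        has_real_derivative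
       (- k * Y t / r t ^ 3 + 3 * k * (x t * X t + y t * Y t) * y t / r t ^ 5) * L t
         + - k * y t / r t ^ 3 * dL t
         - ((k * w t * (y t * X t - x t * Y t)
              + k * y t * (w t * X t + y t * U t - (u t * Y t + x t * W t))) * r t ^ 3
            - k * y t * (y t * X t - x t * Y t) * (3 * r t ^ 2 * ((x t * u t + y t * w t) / r t)))
           / (r t ^ 3 * r t ^ 3)) (at t)"
      using r_pos[of t]
      by (auto intro!: derivative_eq_intros dx dy dw' dr dX dY dW'
          simp: L_const[of t] dL_const[of t] algebra_simps)
    \<comment> \<open>Extracting k / r^5 leaves a polynomial in which r occurs only squared, so
      substituting x^2 + y^2 reduces the claim to an algebraic identity.\<close>
    moreover have "(- k * Y t / r t ^ 3 + 3 * k * (x t * X t + y t * Y t) * y t / r t ^ 5) * L t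
         + - k * y t / r t ^ 3 * dL t
         - ((k * w t * (y t * X t - x t * Y t)
              + k * y t * (w t * X t + y t * U t - (u t * Y t + x t * W t))) * r t ^ 3
            - k * y t * (y t * X t - x t * Y t) * (3 * r t ^ 2 * ((x t * u t + y t * w t) / r t)))
           / (r t ^ 3 * r t ^ 3)
       = k / r t ^ 5 * ((- Y t * (r t)\<^sup>2 + 3 * (x t * X t + y t * Y t) * y t) * L t
         - y t * dL t * (r t)\<^sup>2
         - (w t * (y t * X t - x t * Y t)
              + y t * (w t * X t + y t * U t - (u t * Y t + x t * W t))) * (r t)\<^sup>2
            + 3 * y t * (y t * X t - x t * Y t) * (x t * u t + y t * w t))"
      using r_pos[of t] by (simp add: field_simps eval_nat_numeral)
    moreover have "(- Y t * (r t)\<^sup>2 + 3 * (x t * X t + y t * Y t) * y t) * L t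
         - y t * dL t * (r t)\<^sup>2
         - (w t * (y t * X t - x t * Y t)
              + y t * (w t * X t + y t * U t - (u t * Y t + x t * W t))) * (r t)\<^sup>2
            + 3 * y t * (y t * X t - x t * Y t) * (x t * u t + y t * w t) = 0"
      unfolding r_sq L_def dL_def by algebra
    ultimately show ?thesis by simp
  qed
  have 2: "((\<lambda>t. U t * L 0 + u t * dL 0 + k * x t * (x t * Y t - y t * X t) / r t ^ 3)
      has_real_derivative 0) (at t)" for t
  proof -
    have "((\<lambda>t. U t * L 0 + u t * dL 0 + k * x t * (x t * Y t - y t * X t) / r t ^ 3)
        has_real_derivative
       (- k * X t / r t ^ 3 + 3 * k * (x t * X t + y t * Y t) * x t / r t ^ 5) * L t
         + - k * x t / r t ^ 3 * dL t
         + ((k * u t * (x t * Y t - y t * X t)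
              + k * x t * (u t * Y t + x t * W t - (w t * X t + y t * U t))) * r t ^ 3
            - k * x t * (x t * Y t - y t * X t) * (3 * r t ^ 2 * ((x t * u t + y t * w t) / r t)))
           / (r t ^ 3 * r t ^ 3)) (at t)"
      using r_pos[of t]
      by (auto intro!: derivative_eq_intros dx dy du' dr dX dY dU'
          simp: L_const[of t] dL_const[of t] algebra_simps)
    moreover have "(- k * X t / r t ^ 3 + 3 * k * (x t * X t + y t * Y t) * x t / r t ^ 5) * L t
         + - k * x t / r t ^ 3 * dL t
         + ((k * u t * (x t * Y t - y t * X t)
              + k * x t * (u t * Y t + x t * W t - (w t * X t + y t * U t))) * r t ^ 3
            - k * x t * (x t * Y t - y t * X t) * (3 * r t ^ 2 * ((x t * u t + y t * w t) / r t)))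
           / (r t ^ 3 * r t ^ 3)
       = k / r t ^ 5 * ((- X t * (r t)\<^sup>2 + 3 * (x t * X t + y t * Y t) * x t) * L t
         - x t * dL t * (r t)\<^sup>2
         + (u t * (x t * Y t - y t * X t)
              + x t * (u t * Y t + x t * W t - (w t * X t + y t * U t))) * (r t)\<^sup>2
            - 3 * x t * (x t * Y t - y t * X t) * (x t * u t + y t * w t))"
      using r_pos[of t] by (simp add: field_simps eval_nat_numeral)
    moreover have "(- X t * (r t)\<^sup>2 + 3 * (x t * X t + y t * Y t) * x t) * L t
         - x t * dL t * (r t)\<^sup>2
         + (u t * (x t * Y t - y t * X t)
              + x t * (u t * Y t + x t * W t - (w t * X t + y t * U t))) * (r t)\<^sup>2
            - 3 * x t * (x t * Y t - y t * X t) * (x t * u t + y t * w t) = 0"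
      unfolding r_sq L_def dL_def by algebra
    ultimately show ?thesis by simp
  qed
  show "W t * L 0 + w t * dL 0 - k * y t * (y t * X t - x t * Y t) / r t ^ 3
    = W 0 * L 0 + w 0 * dL 0 - k * y 0 * (y 0 * X 0 - x 0 * Y 0) / r 0 ^ 3"
    by (rule const_if_DERIV_0[OF 1])
  show "U t * L 0 + u t * dL 0 + k * x t * (x t * Y t - y t * X t) / r t ^ 3
    = U 0 * L 0 + u 0 * dL 0 + k * x 0 * (x 0 * Y 0 - y 0 * X 0) / r 0 ^ 3"
    by (rule const_if_DERIV_0[OF 2])
qed

text \<open>The three linearised integrals are independent, so their common kernel is the line spanned
  by the velocity of the flow.\<close>

lemma increment_over_period:
  assumes T: "T > 0" "x T = x 0" "y T = y 0" "u T = u 0" "w T = w 0"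
  shows "\<exists>s. X T - X 0 = s * u 0 \<and> Y T - Y 0 = s * w 0 \<and>
    U T - U 0 = s * (- k * x 0 / r 0 ^ 3) \<and> W T - W 0 = s * (- k * y 0 / r 0 ^ 3)"
proof -
  define a b c d where "a = X T - X 0" and "b = Y T - Y 0" and "c = U T - U 0" and "d = W T - W 0"
  have L: "L 0 \<noteq> 0" using L_nonzero T by blast
  have rT: "r T = r 0" by (simp add: r_def T)
  \<comment> \<open>If the position increment is \<open>s\<close> times the velocity, its cross
    product with the position is \<open>s * L 0\<close>; this dictates \<open>s\<close>.\<close>
  define s where "s = (x 0 * b - y 0 * a) / L 0"
  have l: "a * w 0 + x 0 * d - b * u 0 - y 0 * c = 0"
    using dL_const[of T] by (simp add: dL_def T a_def b_def c_def d_def algebra_simps)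
  \<comment> \<open>The terms with \<open>dL 0\<close> agree at both ends and cancel, so each
    linearised Laplace--Runge--Lenz component determines one component of the velocity
    increment.\<close>
  have "d * L 0 = k * y 0 * (y 0 * a - x 0 * b) / r 0 ^ 3"
    using dLRL_const(1)[of T] r_pos[of 0]
    by (simp add: T rT a_def b_def d_def field_simps)
  then have d: "d = s * (- k * y 0 / r 0 ^ 3)"
    using L r_pos[of 0] by (simp add: s_def field_simps)
  have "c * L 0 = - k * x 0 * (x 0 * b - y 0 * a) / r 0 ^ 3"
    using dLRL_const(2)[of T] r_pos[of 0]
    by (simp add: T rT a_def b_def c_def field_simps)
  then have c: "c = s * (- k * x 0 / r 0 ^ 3)"
    using L r_pos[of 0] by (simp add: s_def field_simps)
  \<comment> \<open>The velocity increment is parallel to the position, so the angular momentum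
    relation \<open>l\<close> forces the position increment to be parallel to the velocity.\<close>
  have "x 0 * d - y 0 * c = 0" by (simp add: c d)
  with l have ab: "a * w 0 = b * u 0" by simp
  have "a * L 0 = (x 0 * b - y 0 * a) * u 0" "b * L 0 = (x 0 * b - y 0 * a) * w 0"
    using ab by (simp_all add: L_def) (algebra, algebra)
  then have "a = s * u 0" "b = s * w 0"
    using L by (simp_all add: s_def field_simps)
  with c d show ?thesis unfolding a_def b_def c_def d_def by blast
qed

end

section \<open>The monodromy matrix\<close>

lemma has_real_derivative_component:
  assumes "(f has_vector_derivative f') (at t)"
  shows "((\<lambda>t. f t $ i) has_real_derivative f' $ i) (at t)"
  using bounded_linear.has_vector_derivative[OF bounded_linear_vec_nth assms]
  by (simp add: has_real_derivative_iff_has_vector_derivative)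

locale kepler_orbit =
  fixes \<mu> m T :: real and \<gamma> :: "real \<Rightarrow> real^2"
  assumes \<mu>_pos: "\<mu> > 0" and m_pos: "m > 0"
    and solution: "kepler_solution \<mu> m \<gamma>"
    and T_pos: "T > 0" and periodic: "\<gamma> (t + T) = \<gamma> t"
begin

lemma nonzero: "\<gamma> t \<noteq> 0"
  using solution by (simp add: kepler_solution_def)

lemma d\<gamma>: "(\<gamma> has_vector_derivative velocity \<gamma> t) (at t)"
  using solution by (simp add: kepler_solution_def velocity_def vector_derivative_works)

lemma dv: "(velocity \<gamma> has_vector_derivative - (m / (\<mu> * norm (\<gamma> t) ^ 3)) *\<^sub>R \<gamma> t) (at t)"
proof -
  have "(velocity \<gamma> has_vector_derivative vector_derivative (velocity \<gamma>) (at t)) (at t)"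
    using solution by (simp add: kepler_solution_def vector_derivative_works)
  moreover have "\<mu> *\<^sub>R vector_derivative (velocity \<gamma>) (at t) = - (m / norm (\<gamma> t) ^ 3) *\<^sub>R \<gamma> t"
    using solution by (simp add: kepler_solution_def)
  then have "(1 / \<mu>) *\<^sub>R \<mu> *\<^sub>R vector_derivative (velocity \<gamma>) (at t)
      = (1 / \<mu>) *\<^sub>R (- (m / norm (\<gamma> t) ^ 3) *\<^sub>R \<gamma> t)"
    by (rule arg_cong)
  then have "vector_derivative (velocity \<gamma>) (at t) = - (m / (\<mu> * norm (\<gamma> t) ^ 3)) *\<^sub>R \<gamma> t"
    using \<mu>_pos by simp
  ultimately show ?thesis by simp
qed

lemma velocity_periodic: "velocity \<gamma> (t + T) = velocity \<gamma> t"
proof -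
  have "((\<lambda>s. \<gamma> (s + T)) has_vector_derivative velocity \<gamma> (t + T)) (at t)"
    using vector_diff_chain_at[where f = "\<lambda>s. s + T" and g = \<gamma> and f' = 1 and x = t, OF _ d\<gamma>]
      has_vector_derivative_add[OF has_vector_derivative_id has_vector_derivative_const]
    by (simp add: o_def id_def)
  then have "(\<gamma> has_vector_derivative velocity \<gamma> (t + T)) (at t)"
    by (simp add: periodic)
  then show ?thesis using d\<gamma> vector_derivative_unique_at by blast
qed

section \<open>Variational equation along the orbit\<close>

abbreviation z :: "real \<Rightarrow> real^(2+2)" where "z \<equiv> phase_curve \<mu> \<gamma>"

definition A :: "real \<Rightarrow> real^(2+2)^(2+2)" where
  "A t = symplectic_J ** hessian (kepler_hamiltonian \<mu> m) (z t)"

definition dz :: "real \<Rightarrow> real^(2+2)" where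
  "dz t = pair_vec (- (m / norm (\<gamma> t) ^ 3) *\<^sub>R \<gamma> t) (velocity \<gamma> t)"

lemma A_pair_vec:
  "A t *v pair_vec \<eta> \<xi> =
    pair_vec (- ((m / norm (\<gamma> t) ^ 3) *\<^sub>R \<xi> - (3 * m * inner (\<gamma> t) \<xi> / norm (\<gamma> t) ^ 5) *\<^sub>R \<gamma> t))
      ((1 / \<mu>) *\<^sub>R \<eta>)"
  unfolding A_def phase_curve_def using nonzero \<mu>_pos by (intro symplectic_J_hessian) auto

lemma z_has_vector_derivative: "(z has_vector_derivative dz t) (at t)"
proof -
  have "((\<lambda>t. pair_vec (\<mu> *\<^sub>R velocity \<gamma> t) (\<gamma> t)) has_vector_derivative
      pair_vec (\<mu> *\<^sub>R (- (m / (\<mu> * norm (\<gamma> t) ^ 3)) *\<^sub>R \<gamma> t)) (velocity \<gamma> t)) (at t)"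
    by (rule has_vector_derivative_pair_vec[OF
          bounded_linear.has_vector_derivative[OF bounded_linear_scaleR_right dv] d\<gamma>])
  then show ?thesis using \<mu>_pos by (simp add: dz_def phase_curve_def[abs_def])
qed

lemma A_continuous: "continuous_on UNIV A"
proof -
  have "continuous_on UNIV z"
    by (meson continuous_at_imp_continuous_on has_vector_derivative_continuous
        z_has_vector_derivative)
  then have "continuous_on UNIV (\<lambda>t. hessian (kepler_hamiltonian \<mu> m) (z t))"
    by (rule continuous_hessian_kepler_hamiltonian)
      (use nonzero \<mu>_pos in \<open>auto simp: phase_curve_def\<close>)
  then show ?thesis unfolding A_def[abs_def]
    by (rule bounded_bilinear.continuous_on[OF bounded_bilinear_matrix_mult continuous_on_const])
qed

text \<open>Chain rule for \<open>dz = J \<nabla>H(z)\<close>.\<close>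

lemma dz_variational: "(dz has_vector_derivative A t *v dz t) (at t)"
proof -
  let ?H = "kepler_hamiltonian \<mu> m"
  have nz: "position (z t) \<noteq> 0" for t using nonzero by (simp add: phase_curve_def)
  have \<mu>: "\<mu> \<noteq> 0" using \<mu>_pos by simp
  have dz: "dz = (\<lambda>t. symplectic_J *v gradient ?H (z t))"
    using gradient_kepler_hamiltonian[OF nz \<mu>, of m] \<mu>
    by (simp add: fun_eq_iff symplectic_J_pair_vec dz_def phase_curve_def)
  have "((\<lambda>t. gradient ?H (z t)) has_derivative
      (\<lambda>h. kepler_hessian_apply \<mu> m (position (z t)) (h *\<^sub>R dz t))) (at t)"
    by (rule has_derivative_compose[OF z_has_vector_derivative[unfolded has_vector_derivative_def]
          has_derivative_gradient_kepler_hamiltonian[OF nz \<mu>]])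
  then have "((\<lambda>t. gradient ?H (z t)) has_vector_derivative hessian ?H (z t) *v dz t) (at t)"
    by (simp add: hessian_kepler_hamiltonian[OF nz \<mu>, symmetric] matrix_vector_mult_scaleR
        has_vector_derivative_def)
  from bounded_linear.has_vector_derivative[OF
      bounded_bilinear.bounded_linear_right[OF bounded_bilinear_matrix_vector_mult] this]
  have "((\<lambda>t. symplectic_J *v gradient ?H (z t)) has_vector_derivative
      symplectic_J *v (hessian ?H (z t) *v dz t)) (at t)" .
  then show ?thesis by (simp add: A_def matrix_vector_mul_assoc dz[symmetric])
qed

text \<open>Infinitesimal generator of the scaling symmetry \<open>\<gamma>(t) \<mapsto> \<lambda>\<^sup>2 \<gamma>(t / \<lambda>\<^sup>3)\<close>.\<close>

definition scaling_variation :: "real \<Rightarrow> real^(2+2)" where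
  "scaling_variation t = pair_vec (- \<mu> *\<^sub>R velocity \<gamma> t) (2 *\<^sub>R \<gamma> t) - (3 * t) *\<^sub>R dz t"

lemma scaling_variation_variational:
  "(scaling_variation has_vector_derivative A t *v scaling_variation t) (at t)"
proof -
  have 1: "((\<lambda>t. pair_vec (- \<mu> *\<^sub>R velocity \<gamma> t) (2 *\<^sub>R \<gamma> t)) has_vector_derivative
      pair_vec (- \<mu> *\<^sub>R (- (m / (\<mu> * norm (\<gamma> t) ^ 3)) *\<^sub>R \<gamma> t)) (2 *\<^sub>R velocity \<gamma> t)) (at t)"
    by (rule has_vector_derivative_pair_vec[OF
          bounded_linear.has_vector_derivative[OF bounded_linear_scaleR_right dv]
          bounded_linear.has_vector_derivative[OF bounded_linear_scaleR_right d\<gamma>]])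
  have 2: "((\<lambda>t. (3 * t) *\<^sub>R dz t) has_vector_derivative
      (3 * t) *\<^sub>R (A t *v dz t) + 3 *\<^sub>R dz t) (at t)"
    by (rule has_vector_derivative_scaleR[OF _ dz_variational]) (auto intro!: derivative_eq_intros)
  \<comment> \<open>The doubled position gives the force coefficient -(2 - 6) = 4. The next step
    splits it as 1 + 3, and the position coefficient -1 as 2 - 3; the multiple of \<open>dz\<close>
    so split off matches the derivative of the factor \<open>3 * t\<close>.\<close>
  have "A t *v pair_vec (- \<mu> *\<^sub>R velocity \<gamma> t) (2 *\<^sub>R \<gamma> t) =
      pair_vec ((4 * (m / norm (\<gamma> t) ^ 3)) *\<^sub>R \<gamma> t) (- velocity \<gamma> t)"
    using nonzero[of t] \<mu>_pos
    by (simp add: A_pair_vec dot_square_norm eval_nat_numeral scaleR_left_diff_distrib[symmetric]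
        scaleR_minus_left[symmetric] del: scaleR_minus_left)
  also have "\<dots> = pair_vec (- \<mu> *\<^sub>R (- (m / (\<mu> * norm (\<gamma> t) ^ 3)) *\<^sub>R \<gamma> t)) (2 *\<^sub>R velocity \<gamma> t)
      - 3 *\<^sub>R dz t"
    using \<mu>_pos unfolding dz_def
    by (auto simp: pair_vec_def vec_eq_iff split: sum.split)
  finally have "A t *v scaling_variation t =
      pair_vec (- \<mu> *\<^sub>R (- (m / (\<mu> * norm (\<gamma> t) ^ 3)) *\<^sub>R \<gamma> t)) (2 *\<^sub>R velocity \<gamma> t)
      - ((3 * t) *\<^sub>R (A t *v dz t) + 3 *\<^sub>R dz t)"
    by (simp add: scaling_variation_def matrix_vector_mult_diff_distrib matrix_vector_mult_scaleR)
  with has_vector_derivative_diff[OF 1 2] show ?thesis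
    by (simp add: scaling_variation_def[abs_def])
qed

section \<open>Action of the monodromy matrix on variational solutions\<close>

abbreviation M :: "real^(2+2)^(2+2)" where "M \<equiv> monodromy_matrix \<mu> m \<gamma> T"

text \<open>Existence and uniqueness for continuous coefficients turn the definite description into
  usable equations.\<close>

lemma fundamental_solution_eqs:
  "fundamental_solution \<mu> m \<gamma> 0 = mat 1"
  "(fundamental_solution \<mu> m \<gamma> has_vector_derivative A t ** fundamental_solution \<mu> m \<gamma> t) (at t)"
proof -
  have iff: "is_fundamental_solution \<mu> m \<gamma> \<phi> \<longleftrightarrow>
      \<phi> 0 = mat 1 \<and> (\<forall>t. (\<phi> has_vector_derivative A t ** \<phi> t) (at t))" for \<phi>
    by (simp add: is_fundamental_solution_def A_def)
  have "\<exists>!\<phi>. is_fundamental_solution \<mu> m \<gamma> \<phi>"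
    unfolding iff
    using fundamental_matrix_exists[OF A_continuous] fundamental_matrix_unique[OF A_continuous]
    by blast
  from theI'[OF this, folded fundamental_solution_def]
  show "fundamental_solution \<mu> m \<gamma> 0 = mat 1"
    "(fundamental_solution \<mu> m \<gamma> has_vector_derivative A t ** fundamental_solution \<mu> m \<gamma> t) (at t)"
    by (simp_all add: iff)
qed

lemma monodromy_solution:
  assumes "\<And>t. (y has_vector_derivative A t *v y t) (at t)"
  shows "M *v y 0 = y T"
  unfolding monodromy_matrix_def
  using linear_system_solution[OF A_continuous fundamental_solution_eqs assms, of T] by simp

lemma dz_T: "dz T = dz 0"
  using periodic[of 0] velocity_periodic[of 0] by (simp add: dz_def)

lemma monodromy_dz: "M *v dz 0 = dz 0"
  using monodromy_solution[OF dz_variational] by (simp add: dz_T)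

text \<open>If \<open>M\<close> were the identity, the scaling variation would return after time
  \<open>T\<close>, but its secular term changes it by \<open>- (3 * T) *\<^sub>R dz 0\<close>. The
  momentum part of \<open>dz 0\<close> is the force, which is nonzero.\<close>

lemma monodromy_ne_1: "M \<noteq> mat 1"
proof
  assume "M = mat 1"
  then have "scaling_variation T = scaling_variation 0"
    using monodromy_solution[OF scaling_variation_variational] by simp
  moreover have "scaling_variation T - scaling_variation 0 = - (3 * T) *\<^sub>R dz 0"
    using periodic[of 0] velocity_periodic[of 0] by (simp add: scaling_variation_def dz_T)
  ultimately have "dz 0 = 0" using T_pos by simp
  then have "momentum (dz 0) = (0 :: real^2)" by (simp add: momentum_def vec_eq_iff)
  then show False using nonzero[of 0] m_pos by (simp add: dz_def)
qed

section \<open>Reduction to planar coordinates and unipotency\<close>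

lemma norm_\<gamma>: "norm (\<gamma> t) = sqrt ((\<gamma> t $ 1)\<^sup>2 + (\<gamma> t $ 2)\<^sup>2)"
  by (simp add: norm_eq_sqrt_inner inner_vec_def sum_2 power2_eq_square)

lemma planar_kepler: "planar_kepler (m / \<mu>) (\<lambda>t. \<gamma> t $ 1) (\<lambda>t. \<gamma> t $ 2)
    (\<lambda>t. velocity \<gamma> t $ 1) (\<lambda>t. velocity \<gamma> t $ 2)"
proof
  show "0 < m / \<mu>" using \<mu>_pos m_pos by simp
  show "\<gamma> t $ 1 \<noteq> 0 \<or> \<gamma> t $ 2 \<noteq> 0" for t
    using nonzero[of t] by (simp add: vec_eq_iff forall_2)
  show "((\<lambda>t. \<gamma> t $ 1) has_real_derivative velocity \<gamma> t $ 1) (at t)"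
    "((\<lambda>t. \<gamma> t $ 2) has_real_derivative velocity \<gamma> t $ 2) (at t)" for t
    by (rule has_real_derivative_component[OF d\<gamma>])+
  show "((\<lambda>t. velocity \<gamma> t $ 1) has_real_derivative
      - (m / \<mu>) * \<gamma> t $ 1 / sqrt ((\<gamma> t $ 1)\<^sup>2 + (\<gamma> t $ 2)\<^sup>2) ^ 3) (at t)"
    "((\<lambda>t. velocity \<gamma> t $ 2) has_real_derivative
      - (m / \<mu>) * \<gamma> t $ 2 / sqrt ((\<gamma> t $ 1)\<^sup>2 + (\<gamma> t $ 2)\<^sup>2) ^ 3) (at t)" for t
    using has_real_derivative_component[OF dv] by (simp_all add: norm_\<gamma>)
qed

text \<open>Dividing the momentum variation by \<mu> gives the velocity variation, which brings in
  the force constant \<open>m / \<mu>\<close>.\<close>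

lemma planar_kepler_variation:
  assumes y: "\<And>t. (y has_vector_derivative A t *v y t) (at t)"
  shows "planar_kepler_variation (m / \<mu>) (\<lambda>t. \<gamma> t $ 1) (\<lambda>t. \<gamma> t $ 2)
    (\<lambda>t. velocity \<gamma> t $ 1) (\<lambda>t. velocity \<gamma> t $ 2)
    (\<lambda>t. position (y t) $ 1) (\<lambda>t. position (y t) $ 2)
    (\<lambda>t. momentum (y t) $ 1 / \<mu>) (\<lambda>t. momentum (y t) $ 2 / \<mu>)"
proof -
  define \<xi> \<eta> :: "real \<Rightarrow> real^2" where "\<xi> t = position (y t)" and "\<eta> t = momentum (y t)" for t
  have A: "A t *v y t = pair_vec (- ((m / norm (\<gamma> t) ^ 3) *\<^sub>R \<xi> t
      - (3 * m * inner (\<gamma> t) (\<xi> t) / norm (\<gamma> t) ^ 5) *\<^sub>R \<gamma> t)) ((1 / \<mu>) *\<^sub>R \<eta> t)" for t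
    unfolding \<xi>_def \<eta>_def A_pair_vec[symmetric] by simp
  have d\<xi>: "(\<xi> has_vector_derivative (1 / \<mu>) *\<^sub>R \<eta> t) (at t)" for t
    using bounded_linear.has_vector_derivative[OF bounded_linear_position y, of t]
    by (simp add: A \<xi>_def[abs_def])
  have d\<eta>: "(\<eta> has_vector_derivative - ((m / norm (\<gamma> t) ^ 3) *\<^sub>R \<xi> t
      - (3 * m * inner (\<gamma> t) (\<xi> t) / norm (\<gamma> t) ^ 5) *\<^sub>R \<gamma> t)) (at t)" for t
    using bounded_linear.has_vector_derivative[OF bounded_linear_momentum y, of t]
    by (simp add: A \<eta>_def[abs_def])
  have d\<eta>': "((\<lambda>t. \<eta> t $ i / \<mu>) has_real_derivative
      - (m / \<mu>) * \<xi> t $ i / norm (\<gamma> t) ^ 3 + 3 * (m / \<mu>) *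
       (\<gamma> t $ 1 * \<xi> t $ 1 + \<gamma> t $ 2 * \<xi> t $ 2) * \<gamma> t $ i / norm (\<gamma> t) ^ 5) (at t)" for i t
  proof -
    have "((\<lambda>t. \<eta> t $ i / \<mu>) has_real_derivative (- ((m / norm (\<gamma> t) ^ 3) *\<^sub>R \<xi> t
      - (3 * m * inner (\<gamma> t) (\<xi> t) / norm (\<gamma> t) ^ 5) *\<^sub>R \<gamma> t)) $ i / \<mu>) (at t)"
      by (rule DERIV_cdivide[OF has_real_derivative_component[OF d\<eta>]])
    moreover have "(- ((m / norm (\<gamma> t) ^ 3) *\<^sub>R \<xi> t
      - (3 * m * inner (\<gamma> t) (\<xi> t) / norm (\<gamma> t) ^ 5) *\<^sub>R \<gamma> t)) $ i / \<mu> =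
      - (m / \<mu>) * \<xi> t $ i / norm (\<gamma> t) ^ 3 + 3 * (m / \<mu>) *
       (\<gamma> t $ 1 * \<xi> t $ 1 + \<gamma> t $ 2 * \<xi> t $ 2) * \<gamma> t $ i / norm (\<gamma> t) ^ 5"
      using \<mu>_pos by (simp add: inner_vec_def sum_2 diff_divide_distrib mult_ac)
    ultimately show ?thesis by simp
  qed
  have "planar_kepler_variation (m / \<mu>) (\<lambda>t. \<gamma> t $ 1) (\<lambda>t. \<gamma> t $ 2)
    (\<lambda>t. velocity \<gamma> t $ 1) (\<lambda>t. velocity \<gamma> t $ 2)
    (\<lambda>t. \<xi> t $ 1) (\<lambda>t. \<xi> t $ 2) (\<lambda>t. \<eta> t $ 1 / \<mu>) (\<lambda>t. \<eta> t $ 2 / \<mu>)"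
    using has_real_derivative_component[OF d\<xi>] d\<eta>'
    by (intro planar_kepler_variation.intro planar_kepler planar_kepler_variation_axioms.intro)
      (simp_all add: norm_\<gamma>)
  then show ?thesis by (simp only: \<xi>_def \<eta>_def)
qed

text \<open>The coordinate result \<open>increment_over_period\<close> is applied to the variational
  solution issuing from \<open>v\<close>.\<close>

lemma monodromy_increment: "\<exists>s. M *v v - v = s *\<^sub>R dz 0"
proof -
  define y where "y t = fundamental_solution \<mu> m \<gamma> t *v v" for t
  have y: "(y has_vector_derivative A t *v y t) (at t)" for t
    unfolding y_def[abs_def] by (rule fundamental_matrix_column[OF fundamental_solution_eqs(2)])
  interpret planar_kepler_variation "m / \<mu>" "\<lambda>t. \<gamma> t $ 1" "\<lambda>t. \<gamma> t $ 2"
    "\<lambda>t. velocity \<gamma> t $ 1" "\<lambda>t. velocity \<gamma> t $ 2"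
    "\<lambda>t. position (y t) $ 1" "\<lambda>t. position (y t) $ 2"
    "\<lambda>t. momentum (y t) $ 1 / \<mu>" "\<lambda>t. momentum (y t) $ 2 / \<mu>"
    by (rule planar_kepler_variation[OF y])
  obtain s where s:
    "position (y T) $ 1 - position (y 0) $ 1 = s * velocity \<gamma> 0 $ 1"
    "position (y T) $ 2 - position (y 0) $ 2 = s * velocity \<gamma> 0 $ 2"
    "momentum (y T) $ 1 / \<mu> - momentum (y 0) $ 1 / \<mu> = s * (- (m / \<mu>) * \<gamma> 0 $ 1 / norm (\<gamma> 0) ^ 3)"
    "momentum (y T) $ 2 / \<mu> - momentum (y 0) $ 2 / \<mu> = s * (- (m / \<mu>) * \<gamma> 0 $ 2 / norm (\<gamma> 0) ^ 3)"
    using increment_over_period[OF T_pos] periodic[of 0] velocity_periodic[of 0]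
    by (auto simp: r_def norm_\<gamma>)
  have pos: "position (y T) - position (y 0) = s *\<^sub>R velocity \<gamma> 0"
    using s(1,2) by (simp add: vec_eq_iff forall_2)
  have mom: "momentum (y T) - momentum (y 0) = s *\<^sub>R (- (m / norm (\<gamma> 0) ^ 3) *\<^sub>R \<gamma> 0)"
    using s(3,4) \<mu>_pos by (simp add: vec_eq_iff forall_2 diff_divide_distrib[symmetric]
        divide_eq_eq)
  have "y T - y 0 = pair_vec (momentum (y T) - momentum (y 0)) (position (y T) - position (y 0))"
    by (auto simp: pair_vec_def momentum_def position_def vec_eq_iff split: sum.split)
  also have "\<dots> = s *\<^sub>R dz 0"
    by (simp only: pos mom dz_def scaleR_pair_vec)
  finally show ?thesis
    by (auto simp: y_def fundamental_solution_eqs(1) monodromy_matrix_def)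
qed

text \<open>\<open>M - mat 1\<close> maps every vector into the line of \<open>dz 0\<close>, and it
  annihilates that line.\<close>

lemma monodromy_unipotent: "(M - mat 1) ** (M - mat 1) = 0"
proof -
  have "((M - mat 1) ** (M - mat 1)) *v v = 0" for v
  proof -
    obtain s where "(M - mat 1) *v v = s *\<^sub>R dz 0"
      using monodromy_increment[of v] by (auto simp: matrix_vector_mult_diff_rdistrib)
    then have "((M - mat 1) ** (M - mat 1)) *v v = s *\<^sub>R ((M - mat 1) *v dz 0)"
      by (simp add: matrix_vector_mul_assoc[symmetric] matrix_vector_mult_scaleR)
    also have "\<dots> = 0" by (simp add: matrix_vector_mult_diff_rdistrib monodromy_dz)
    finally show ?thesis .
  qed
  then show ?thesis by (simp add: matrix_eq)
qed

end

theorem theorem4p5: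
  fixes \<mu> m T :: real and \<gamma> :: "real \<Rightarrow> real ^ 2"
  assumes "\<mu> > 0" and "m > 0"
    and "keplerian_ellipse \<mu> m \<gamma> T"
  shows "elliptic \<mu> m \<gamma> T \<and> spectrally_stable \<mu> m \<gamma> T \<and> \<not> linearly_stable \<mu> m \<gamma> T"
proof -
  interpret kepler_orbit \<mu> m T \<gamma>
    using assms by unfold_locales (auto simp: keplerian_ellipse_def prime_period_def)
  \<comment> \<open>The real identity is transported to the complexified matrix, to which the
    spectral notions refer.\<close>
  have sq: "(complexify M - mat 1) ** (complexify M - mat 1) = 0"
    using arg_cong[OF monodromy_unipotent, of complexify]
    by (simp add: complexify_mult complexify_diff complexify_mat_1 complexify_0)
  have "{c. eigenvalue (complexify M) c} \<subseteq> sphere 0 1"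
    by (auto dest: eigenvalue_unipotent[OF sq])
  moreover have "\<not> diagonalizable (complexify M)"
    using diagonalizable_unipotent[OF sq] monodromy_ne_1
    by (metis complexify_eq_iff complexify_mat_1)
  ultimately show ?thesis
    by (simp add: elliptic_def spectrally_stable_def linearly_stable_def)
qed

end
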